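(* Fix a positive integer $k$ and $\delta > 0$. For every $\epsilon > 0$ there exists $M$ (depending only on $k, \delta, \epsilon$) such that the following holds. Let $n$ be a positive integer and let $\mathcal{G}$ be a family of subsets of $[n]=\{1,\ldots,n\}$ with $|\mathcal{G}| = m$, where $m \geq M$ and $m \geq 2^{\left(\frac{1}{k+1}+\delta\right)n}$. Then the number of unordered $k$-tuples $\{A_1,\ldots,A_k\}$ of $k$ distinct members of $\mathcal{G}$ that are pairwise disjoint is at most \[\left(\frac{k!}{k^{k}}+\epsilon\right)\binom{m}{k}.\]
   Context: $\mathbb{P}[n]$ denotes the power set of $[n]=\{1,\ldots,n\}$, and $\mathcal{G} \subset \mathbb{P}[n]$. Sets $A_1,\ldots,A_k$ are pairwise disjoint if $A_i \cap A_j = \emptyset$ for all $i \neq j$. *)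

theory Defs
  imports Complex_Main
begin

end

theory Submission
  imports Defs "HOL-Analysis.Convex" "HOL-Combinatorics.Multiset_Permutations"
begin

text \<open>
  Let \<open>d s\<close> be the density of ordered pairwise disjoint \<open>s\<close>-tuples in the family. A union bound
  over the small sets (a set of size at most \<open>n/(k+1)\<close> has few subsets compared with \<open>m\<close>) shows that once \<open>t \<ge> 2/\<delta>\<close>,
  only a \<open>1/m\<close> fraction of the \<open>t\<close>-tuples of members have a union of size at most \<open>n/(k+1)\<close>. Among
  \<open>k+1\<close> pairwise disjoint unions inside \<open>[n]\<close> one is that small, so \<open>k+1\<close> random \<open>t\<close>-tuples have pairwise
  disjoint unions with probability at most \<open>(k+1)/m\<close>. By Jensen's inequality, applied to one
  coordinate at a time, this probability is at least \<open>(d (k+1)) ^ (t ^ (k+1))\<close>; hence \<open>d (k+1)\<close> tends to \<open>0\<close>.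
  The Moon--Moser inequalities between consecutive clique densities then bound \<open>d k\<close> by the Turan
  density \<open>k!/k^k\<close> up to an arbitrarily small error.
\<close>

subsection \<open>Ordered cliques and the Moon--Moser inequality\<close>

text \<open>The relation may have loops and entries may repeat: the empty set is disjoint from itself.\<close>

definition cliques :: "('b \<Rightarrow> 'b \<Rightarrow> bool) \<Rightarrow> ('a \<Rightarrow> 'b set) \<Rightarrow> 'a set \<Rightarrow> ('a \<Rightarrow> 'b) set" where
  "cliques R F I = {f \<in> Pi\<^sub>E I F. \<forall>i\<in>I. \<forall>j\<in>I. i \<noteq> j \<longrightarrow> R (f i) (f j)}"

definition nbrs :: "('b \<Rightarrow> 'b \<Rightarrow> bool) \<Rightarrow> 'b set \<Rightarrow> 'a set \<Rightarrow> ('a \<Rightarrow> 'b) \<Rightarrow> 'b set" where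
  "nbrs R V J z = {y \<in> V. \<forall>j\<in>J. R y (z j)}"

lemma finite_cliques:
  assumes "finite I" "\<And>i. i \<in> I \<Longrightarrow> finite (F i)"
  shows "finite (cliques R F I)"
proof (rule finite_subset)
  show "cliques R F I \<subseteq> Pi\<^sub>E I F" by (auto simp: cliques_def)
  show "finite (Pi\<^sub>E I F)" using assms by (rule finite_PiE)
qed

lemma finite_nbrs: "finite V \<Longrightarrow> finite (nbrs R V J z)"
  unfolding nbrs_def by simp

lemma nbrs_fun_upd: "i \<notin> J \<Longrightarrow> nbrs R V J (z(i := y)) = nbrs R V J z"
  unfolding nbrs_def by auto

lemma cliques_cong: "(\<And>i. i \<in> I \<Longrightarrow> F i = F' i) \<Longrightarrow> cliques R F I = cliques R F' I"
  unfolding cliques_def by (metis PiE_cong)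

text \<open>Splitting off coordinate \<open>i\<close> inverts the update; it is reset to
  \<open>undefined\<close> because cliques are extensional functions. Symmetry is used since
  \<open>nbrs\<close> records only one direction of the relation.\<close>

lemma bij_betw_cliques_insert:
  assumes "symp R" "i \<notin> J"
  shows "bij_betw (\<lambda>(z, y). z(i := y)) (SIGMA z:cliques R F J. nbrs R (F i) J z) (cliques R F (insert i J))"
proof (rule bij_betw_byWitness[where f' = "\<lambda>x. (x(i := undefined), x i)"])
  have R: "R a b \<Longrightarrow> R b a" for a b
    using assms(1) by (rule sympD)
  show "\<forall>a\<in>SIGMA z:cliques R F J. nbrs R (F i) J z.
       ((case a of (z, y) \<Rightarrow> z(i := y))(i := undefined), (case a of (z, y) \<Rightarrow> z(i := y)) i) = a"
    using assms(2) by (auto simp: cliques_def fun_eq_iff PiE_def extensional_def)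
  show "\<forall>a'\<in>cliques R F (insert i J).
       (case (a'(i := undefined), a' i) of (z, y) \<Rightarrow> z(i := y)) = a'"
    by auto
  show "(\<lambda>(z, y). z(i := y)) ` (SIGMA z:cliques R F J. nbrs R (F i) J z) \<subseteq> cliques R F (insert i J)"
    using assms(2) by (auto simp: cliques_def nbrs_def PiE_def extensional_def intro: R)
  show "(\<lambda>x. (x(i := undefined), x i)) ` cliques R F (insert i J) \<subseteq> (SIGMA z:cliques R F J. nbrs R (F i) J z)"
    using assms(2) by (auto simp: cliques_def nbrs_def PiE_def extensional_def)
qed

lemma card_cliques_insert:
  assumes "symp R" "i \<notin> J" "finite J" "\<And>j. j \<in> insert i J \<Longrightarrow> finite (F j)"
  shows "card (cliques R F (insert i J)) = (\<Sum>z\<in>cliques R F J. card (nbrs R (F i) J z))"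
proof -
  have "card (cliques R F (insert i J)) = card (SIGMA z:cliques R F J. nbrs R (F i) J z)"
    using bij_betw_cliques_insert[OF assms(1,2)] by (metis bij_betw_same_card)
  then show ?thesis
    using assms(3,4) by (simp add: finite_cliques finite_nbrs)
qed

text \<open>Precomposition with \<open>g\<close> is injective because \<open>g\<close> is onto
  \<open>I\<close>, and it preserves cliques because \<open>g\<close> is injective.\<close>

lemma card_cliques_le_reindex:
  assumes "bij_betw g I' I" "finite I'" "finite V"
  shows "card (cliques R (\<lambda>_. V) I) \<le> card (cliques R (\<lambda>_. V) I')"
proof (rule card_inj_on_le[where f = "\<lambda>f. restrict (f \<circ> g) I'"])
  show "inj_on (\<lambda>f. restrict (f \<circ> g) I') (cliques R (\<lambda>_. V) I)"
  proof (rule inj_onI)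
    fix x y assume x: "x \<in> cliques R (\<lambda>_. V) I" and y: "y \<in> cliques R (\<lambda>_. V) I"
      and eq: "restrict (x \<circ> g) I' = restrict (y \<circ> g) I'"
    have "x a = y a" if a: "a \<in> I" for a
    proof -
      obtain b where "b \<in> I'" "a = g b"
        using a assms(1) by (auto simp: bij_betw_def)
      then show ?thesis
        using fun_cong[OF eq, of b] by simp
    qed
    then show "x = y"
      using x y by (auto simp: cliques_def intro: PiE_ext)
  qed
  show "(\<lambda>f. restrict (f \<circ> g) I') ` cliques R (\<lambda>_. V) I \<subseteq> cliques R (\<lambda>_. V) I'"
    using assms(1) by (auto simp: cliques_def bij_betw_def inj_on_def PiE_def Pi_def; blast)
  show "finite (cliques R (\<lambda>_. V) I')"
    using assms by (intro finite_cliques)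
qed

text \<open>For the Moon--Moser argument: whichever coordinate is deleted, the cliques on the
  remaining ones are equally many.\<close>

lemma card_cliques_const:
  assumes "finite I" "finite V"
  shows "card (cliques R (\<lambda>_. V) I) = card (cliques R (\<lambda>_. V) {..<card I})"
proof -
  obtain g where g: "bij_betw g {..<card I} I"
    using ex_bij_betw_nat_finite[OF assms(1)] by (auto simp: atLeast0LessThan)
  show ?thesis
    using card_cliques_le_reindex[OF g] card_cliques_le_reindex[OF bij_betw_inv_into[OF g]] assms
    by (intro antisym) auto
qed

text \<open>Double counting of triples \<open>(x, y, i)\<close>, where \<open>x\<close> is a clique
  on s+1 coordinates and \<open>y\<close> is related to all its entries except possibly the
  \<open>i\<close>-th. A \<open>y\<close> related to every entry counts s+1 times, any other at most
  once; the lower bound is Cauchy-Schwarz for each \<open>i\<close>.\<close>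

lemma moon_moser:
  assumes "symp R" "finite V"
  defines "h \<equiv> \<lambda>s. card (cliques R (\<lambda>_. V) {..<s::nat})"
  shows "real (Suc s) * real (h (Suc s)) ^ 2
    \<le> real (h s) * (real s * real (h (Suc (Suc s))) + real (card V) * real (h (Suc s)))"
proof -
  define I where "I = {..<Suc s}"
  define C where "C = cliques R (\<lambda>_. V) I"
  define T where "T = (\<Sum>x\<in>C. \<Sum>y\<in>V. card {i\<in>I. y \<in> nbrs R V (I - {i}) x})"
  have [simp]: "finite I" by (simp add: I_def)
  have [simp]: "finite C" unfolding C_def by (simp add: finite_cliques assms(2))
  have cI: "card C = h (Suc s)" by (simp add: C_def I_def h_def)
  have fV [simp]: "finite (nbrs R V J x)" for J :: "nat set" and x
    by (simp add: finite_nbrs assms(2))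
  have h2: "h (Suc (Suc s)) = (\<Sum>x\<in>C. card (nbrs R V I x))"
    unfolding h_def C_def
    using card_cliques_insert[OF assms(1), of "Suc s" I "\<lambda>_. V"] assms(2)
    by (simp add: I_def lessThan_Suc)
  have up: "T \<le> s * h (Suc (Suc s)) + h (Suc s) * card V"
  proof -
    \<comment> \<open>A vertex not adjacent to some entry \<open>x j\<close> can only replace that very entry.\<close>
    have "card {i\<in>I. y \<in> nbrs R V (I - {i}) x} \<le> s * (if y \<in> nbrs R V I x then 1 else 0) + 1"
      if y: "y \<in> V" for x y
    proof (cases "y \<in> nbrs R V I x")
      case True
      have "card {i\<in>I. y \<in> nbrs R V (I - {i}) x} \<le> card I" by (intro card_mono) auto
      then show ?thesis using True by (simp add: I_def)
    next
      case False
      then obtain j where j: "j \<in> I" "\<not> R y (x j)" using y by (auto simp: nbrs_def)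
      then have "{i\<in>I. y \<in> nbrs R V (I - {i}) x} \<subseteq> {j}" by (auto simp: nbrs_def)
      from card_mono[OF _ this] show ?thesis by simp
    qed
    then have "T \<le> (\<Sum>x\<in>C. \<Sum>y\<in>V. s * (if y \<in> nbrs R V I x then 1 else 0) + 1)"
      unfolding T_def by (intro sum_mono)
    also have "\<dots> = (\<Sum>x\<in>C. s * card (nbrs R V I x) + card V)"
    proof (intro sum.cong refl)
      fix x
      have "(\<Sum>y\<in>V. if y \<in> nbrs R V I x then 1 else (0::nat)) = card (V \<inter> nbrs R V I x)"
        using assms(2) by (simp add: sum.If_cases)
      moreover have "V \<inter> nbrs R V I x = nbrs R V I x" by (auto simp: nbrs_def)
      ultimately show "(\<Sum>y\<in>V. s * (if y \<in> nbrs R V I x then 1 else 0) + 1)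
          = s * card (nbrs R V I x) + card V"
        by (simp only: sum.distrib sum_distrib_left[symmetric]) simp
    qed
    also have "\<dots> = s * h (Suc (Suc s)) + h (Suc s) * card V"
      by (simp add: sum.distrib h2 cI sum_distrib_left)
    finally show ?thesis .
  qed
  have T_eq: "T = (\<Sum>i\<in>I. \<Sum>x\<in>C. card (nbrs R V (I - {i}) x))"
  proof -
    have "T = (\<Sum>x\<in>C. \<Sum>i\<in>I. card (nbrs R V (I - {i}) x))"
      unfolding T_def
    proof (intro sum.cong refl)
      fix x
      have "(\<Sum>y\<in>V. card {i\<in>I. y \<in> nbrs R V (I - {i}) x})
          = (\<Sum>y\<in>V. \<Sum>i\<in>I. if y \<in> nbrs R V (I - {i}) x then 1 else 0)"
        by (simp add: sum.If_cases Int_def)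
      also have "\<dots> = (\<Sum>i\<in>I. \<Sum>y\<in>V. if y \<in> nbrs R V (I - {i}) x then 1 else 0)"
        by (rule sum.swap)
      also have "\<dots> = (\<Sum>i\<in>I. card (V \<inter> nbrs R V (I - {i}) x))"
        using assms(2) by (simp add: sum.If_cases)
      also have "\<dots> = (\<Sum>i\<in>I. card (nbrs R V (I - {i}) x))"
        by (intro sum.cong refl arg_cong[where f = card]) (auto simp: nbrs_def)
      finally show "(\<Sum>y\<in>V. card {i\<in>I. y \<in> nbrs R V (I - {i}) x})
          = (\<Sum>i\<in>I. card (nbrs R V (I - {i}) x))" .
    qed
    then show ?thesis by (simp add: sum.swap[of _ I C])
  qed
  \<comment> \<open>Deleting coordinate \<open>i\<close> groups the cliques \<open>x\<close> by the
    remaining clique \<open>z\<close>. Each \<open>z\<close> has \<open>card (nbrs R V J z)\<close>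
    extensions \<open>x\<close>, each admitting equally many \<open>y\<close>, so the sum becomes a
    sum of squares.\<close>
  have low: "real (h (Suc s)) ^ 2 \<le> real (h s) * real (\<Sum>x\<in>C. card (nbrs R V (I - {i}) x))"
    if i: "i \<in> I" for i
  proof -
    define J where "J = I - {i}"
    define Z where "Z = cliques R (\<lambda>_. V) J"
    have J: "i \<notin> J" "finite J" "I = insert i J" using i by (auto simp: J_def)
    have "card Z = h s"
      using card_cliques_const[OF J(2) assms(2), of R] i by (simp add: Z_def h_def J_def I_def)
    have "(\<Sum>x\<in>C. card (nbrs R V J x))
        = (\<Sum>(z, y)\<in>(SIGMA z:Z. nbrs R V J z). card (nbrs R V J (z(i := y))))"
      using sum.reindex_bij_betw[OF bij_betw_cliques_insert[OF assms(1) J(1), of "\<lambda>_. V"],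
          of "\<lambda>x. card (nbrs R V J x)", symmetric]
      by (simp add: C_def J(3) Z_def case_prod_unfold)
    also have "\<dots> = (\<Sum>(z, y)\<in>(SIGMA z:Z. nbrs R V J z). card (nbrs R V J z))"
      by (simp add: nbrs_fun_upd[OF J(1)])
    also have "\<dots> = (\<Sum>z\<in>Z. \<Sum>y\<in>nbrs R V J z. card (nbrs R V J z))"
      by (rule sum.Sigma[symmetric]) (auto simp: Z_def J finite_cliques assms(2))
    also have "\<dots> = (\<Sum>z\<in>Z. card (nbrs R V J z) ^ 2)"
      by (simp add: power2_eq_square)
    finally have sq: "(\<Sum>x\<in>C. card (nbrs R V J x)) = (\<Sum>z\<in>Z. card (nbrs R V J z) ^ 2)" .
    have "h (Suc s) = (\<Sum>z\<in>Z. card (nbrs R V J z))"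
      unfolding cI[symmetric] C_def J(3) Z_def
      using J assms(2) by (intro card_cliques_insert[OF assms(1)]) auto
    then have "real (h (Suc s)) ^ 2 = (\<Sum>z\<in>Z. 1 * real (card (nbrs R V J z))) ^ 2" by simp
    also have "\<dots> \<le> (\<Sum>z\<in>Z. 1 ^ 2) * (\<Sum>z\<in>Z. real (card (nbrs R V J z)) ^ 2)"
      by (rule Cauchy_Schwarz_ineq_sum)
    also have "\<dots> = real (h s) * real (\<Sum>x\<in>C. card (nbrs R V J x))"
      unfolding sq by (simp add: \<open>card Z = h s\<close>)
    finally show ?thesis unfolding J_def .
  qed
  have "real (Suc s) * real (h (Suc s)) ^ 2 = (\<Sum>i\<in>I. real (h (Suc s)) ^ 2)"
    by (simp add: I_def)
  also have "\<dots> \<le> (\<Sum>i\<in>I. real (h s) * real (\<Sum>x\<in>C. card (nbrs R V (I - {i}) x)))"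
    by (intro sum_mono low)
  also have "\<dots> = real (h s) * real T"
    unfolding T_eq by (simp add: sum_distrib_left)
  also have "\<dots> \<le> real (h s) * real (s * h (Suc (Suc s)) + h (Suc s) * card V)"
    using up by (intro mult_left_mono) (simp_all only: of_nat_le_iff of_nat_0_le_iff)
  finally show ?thesis by (simp add: mult.commute)
qed

section \<open>Normalised clique densities\<close>

text \<open>For nonempty \<open>F i\<close>, the probability that independent uniform choices form a
  clique. Separate sets \<open>F i\<close> allow blowing up one coordinate at a time.\<close>

definition density :: "('b \<Rightarrow> 'b \<Rightarrow> bool) \<Rightarrow> ('a \<Rightarrow> 'b set) \<Rightarrow> 'a set \<Rightarrow> real" where
  "density R F I = real (card (cliques R F I)) / (\<Prod>i\<in>I. real (card (F i)))"

lemma card_cliques_le: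
  assumes "finite I" "\<And>i. i \<in> I \<Longrightarrow> finite (F i)"
  shows "card (cliques R F I) \<le> (\<Prod>i\<in>I. card (F i))"
proof -
  have "card (cliques R F I) \<le> card (Pi\<^sub>E I F)"
    using assms by (intro card_mono finite_PiE) (auto simp: cliques_def)
  then show ?thesis using assms by (simp add: card_PiE)
qed

lemma density_nonneg: "density R F I \<ge> 0"
  unfolding density_def by (simp add: prod_nonneg)

text \<open>All terms of \<open>moon_moser\<close> scale with \<open>m ^ (2 * s + 2)\<close>, which
  cancels.\<close>

lemma density_moon_moser:
  fixes V :: "'b set"
  assumes "symp R" "finite V" "V \<noteq> {}"
  defines "d \<equiv> \<lambda>s. density R (\<lambda>_. V) {..<s::nat}"
  shows "real (Suc s) * d (Suc s) ^ 2 \<le> d s * (real s * d (Suc (Suc s)) + d (Suc s))"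
proof -
  define m where "m = real (card V)"
  have m: "m > 0" using assms by (simp add: m_def card_gt_0_iff)
  have h: "real (card (cliques R (\<lambda>_. V) {..<s})) = d s * m ^ s" for s :: nat
    using m by (simp add: d_def density_def m_def)
  have "real (Suc s) * (d (Suc s) * m ^ Suc s) ^ 2
      \<le> d s * m ^ s * (real s * (d (Suc (Suc s)) * m ^ Suc (Suc s)) + m * (d (Suc s) * m ^ Suc s))"
    using moon_moser[OF assms(1,2), of s] unfolding h m_def[symmetric] .
  also have "\<dots> = (d s * (real s * d (Suc (Suc s)) + d (Suc s))) * (m ^ Suc s) ^ 2"
    by (simp add: algebra_simps power2_eq_square)
  finally have "(real (Suc s) * d (Suc s) ^ 2) * (m ^ Suc s) ^ 2
      \<le> (d s * (real s * d (Suc (Suc s)) + d (Suc s))) * (m ^ Suc s) ^ 2"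
    by (simp add: power_mult_distrib mult.assoc)
  then show ?thesis using m by (simp only: mult_le_cancel_right_pos zero_less_power)
qed

subsection \<open>Vanishing density of (k+1)-cliques and the Turan bound\<close>

text \<open>Downward induction from \<open>k\<close> bounds every ratio
  \<open>d (Suc s) / d s\<close>; multiplying the ratios from \<open>d 0 = 1\<close> upwards
  telescopes.\<close>

lemma turan_density_step:
  fixes d :: "nat \<Rightarrow> real"
  assumes nonneg: "\<And>s. d s \<ge> 0" and d0: "d 0 = 1" and k: "k > 0" "d k > 0"
    and mm: "\<And>s. real (Suc s) * d (Suc s) ^ 2 \<le> d s * (real s * d (Suc (Suc s)) + d (Suc s))"
  shows "d k \<le> (\<Prod>s<k. 1 - real s / real k + d (Suc k) / d k)"
proof -
  define \<rho> where "\<rho> = d (Suc k) / d k"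
  \<comment> \<open>By Moon--Moser, \<open>d s = 0\<close> would force \<open>d (Suc s) = 0\<close>,
    so positivity passes down from \<open>k\<close>.\<close>
  have pos: "s \<le> k \<Longrightarrow> d s > 0" for s
  proof (induction rule: inc_induct)
    case base then show ?case by (rule k)
  next
    case (step s)
    have "d s \<noteq> 0"
    proof
      assume "d s = 0"
      then have "real (Suc s) * d (Suc s) ^ 2 \<le> 0" using mm[of s] by simp
      moreover have "real (Suc s) * d (Suc s) ^ 2 > 0" using step.IH by simp
      ultimately show False by simp
    qed
    then show ?case using nonneg[of s] by simp
  qed
  have ratio: "s \<le> k \<Longrightarrow> d (Suc s) \<le> (1 - real s / real k + \<rho>) * d s" for s
  proof (induction rule: inc_induct)
    case base then show ?case using k by (simp add: \<rho>_def)
  next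
    case (step s)
    let ?D = "d (Suc s)"
    have D: "?D > 0" using step.hyps by (intro pos) simp
    have "real (Suc s) * ?D ^ 2 \<le> d s * (real s * ((1 - real (Suc s) / real k + \<rho>) * ?D) + ?D)"
      by (rule order_trans[OF mm]) (intro mult_left_mono add_mono step.IH nonneg order_refl, simp)
    then have "(real (Suc s) * ?D) * ?D \<le> (d s * (real s * (1 - real (Suc s) / real k + \<rho>) + 1)) * ?D"
      by (simp add: power2_eq_square algebra_simps)
    then have "real (Suc s) * ?D \<le> d s * (real s * (1 - real (Suc s) / real k + \<rho>) + 1)"
      using D by (simp only: mult_le_cancel_right_pos)
    \<comment> \<open>The identity \<open>s * (1 - (s+1)/k) + 1 = (s+1) * (1 - s/k)\<close> shows
      that the ratios \<open>1 - s/k\<close> reproduce themselves.\<close>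
    also have "\<dots> = d s * (real (Suc s) * (1 - real s / real k) + real s * \<rho>)"
      by (simp add: algebra_simps add_divide_distrib)
    \<comment> \<open>Enlarging the error term lets \<open>Suc s\<close> factor out and keeps the
      same \<open>\<rho>\<close> at every level.\<close>
    also have "\<dots> \<le> d s * (real (Suc s) * (1 - real s / real k) + real (Suc s) * \<rho>)"
      using nonneg k by (intro mult_left_mono add_mono mult_right_mono) (auto simp: \<rho>_def)
    also have "\<dots> = real (Suc s) * ((1 - real s / real k + \<rho>) * d s)"
      by (simp add: algebra_simps)
    finally show ?case by (simp only: mult_le_cancel_left_pos of_nat_0_less_iff zero_less_Suc)
  qed
  have "s \<le> k \<Longrightarrow> d s \<le> (\<Prod>i<s. 1 - real i / real k + \<rho>)" for s
  proof (induction s)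
    case 0 then show ?case by (simp add: d0)
  next
    case (Suc s)
    have \<rho>0: "\<rho> \<ge> 0" using nonneg k by (simp add: \<rho>_def)
    have "real s / real k \<le> 1" using Suc.prems by simp
    then have "d (Suc s) \<le> (1 - real s / real k + \<rho>) * (\<Prod>i<s. 1 - real i / real k + \<rho>)"
      using Suc \<rho>0 by (intro order_trans[OF ratio mult_left_mono]) auto
    then show ?case by (simp add: mult.commute)
  qed
  from this[of k] show ?thesis by (simp add: \<rho>_def)
qed

text \<open>The bound at error \<open>\<rho> = 0\<close>: the limiting density of ordered
  \<open>k\<close>-cliques in balanced complete \<open>k\<close>-partite graphs.\<close>

lemma prod_turan_ratios:
  "k > 0 \<Longrightarrow> (\<Prod>s<k. 1 - real s / real k) = fact k / real k ^ k"
proof -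
  assume k: "k > 0"
  have "(\<Prod>s<k. 1 - real s / real k) = (\<Prod>s<k. real (k - s) / real k)"
    using k by (intro prod.cong) (auto simp: field_simps of_nat_diff)
  also have "\<dots> = (\<Prod>s<k. real (k - s)) / real k ^ k"
    by (simp add: prod_dividef)
  also have "(\<Prod>s<k. real (k - s)) = (\<Prod>s<k. real (Suc s))"
    by (subst prod.nat_diff_reindex[symmetric]) (intro prod.cong, auto)
  also have "\<dots> = fact k"
    by (simp add: fact_prod_Suc atLeast0LessThan)
  finally show ?thesis .
qed

text \<open>The product bound is continuous in the error ratio, so a small enough ratio costs at
  most \<open>\<epsilon>\<close>. The threshold \<open>\<eta>\<close> is uniform over all sequences
  \<open>d\<close>.\<close>

lemma turan_density:
  fixes \<epsilon> :: real
  assumes k: "k > 0" and \<epsilon>: "\<epsilon> > 0"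
  obtains \<eta> where "\<eta> > 0"
    "\<And>d :: nat \<Rightarrow> real. \<lbrakk>\<And>s. d s \<ge> 0; d 0 = 1; d (Suc k) \<le> \<eta>;
       \<And>s. real (Suc s) * d (Suc s) ^ 2 \<le> d s * (real s * d (Suc (Suc s)) + d (Suc s))\<rbrakk>
       \<Longrightarrow> d k \<le> fact k / real k ^ k + \<epsilon>"
proof -
  let ?g = "\<lambda>\<rho>. \<Prod>s<k. 1 - real s / real k + \<rho>"
  have "(?g \<longlongrightarrow> (\<Prod>s<k. 1 - real s / real k + 0)) (at_right 0)"
    by (intro tendsto_intros)
  then have "(?g \<longlongrightarrow> fact k / real k ^ k) (at_right 0)"
    using prod_turan_ratios[OF k] by simp
  then have "eventually (\<lambda>\<rho>. ?g \<rho> < fact k / real k ^ k + \<epsilon>) (at_right 0)"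
    by (rule order_tendstoD) (use \<epsilon> in simp)
  then obtain b where b: "b > 0" "\<And>\<rho>. 0 < \<rho> \<Longrightarrow> \<rho> < b \<Longrightarrow> ?g \<rho> < fact k / real k ^ k + \<epsilon>"
    by (auto simp: eventually_at_right_field)
  define \<rho>0 where "\<rho>0 = b / 2"
  have \<rho>0: "\<rho>0 > 0" "?g \<rho>0 < fact k / real k ^ k + \<epsilon>"
    using b by (auto simp: \<rho>0_def)
  show ?thesis
  \<comment> \<open>If \<open>d k > \<epsilon>\<close>, this threshold keeps the ratio
    \<open>d (Suc k) / d k\<close> below \<open>\<rho>0\<close>; if
    \<open>d k \<le> \<epsilon>\<close>, the claim is immediate.\<close>
  proof (rule that[of "\<rho>0 * \<epsilon>"])
    show "\<rho>0 * \<epsilon> > 0" using \<rho>0 \<epsilon> by simp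
    fix d :: "nat \<Rightarrow> real"
    assume d: "\<And>s. d s \<ge> 0" "d 0 = 1" "d (Suc k) \<le> \<rho>0 * \<epsilon>"
      "\<And>s. real (Suc s) * d (Suc s) ^ 2 \<le> d s * (real s * d (Suc (Suc s)) + d (Suc s))"
    show "d k \<le> fact k / real k ^ k + \<epsilon>"
    proof (cases "d k \<le> \<epsilon>")
      case True
      have "fact k / real k ^ k \<ge> (0::real)" by simp
      with True show ?thesis by linarith
    next
      case False
      then have dk: "d k > \<epsilon>" "d k > 0" using \<epsilon> by auto
      have "d (Suc k) \<le> \<rho>0 * d k"
        using d(3) dk \<rho>0 by (meson less_imp_le mult_left_mono order_trans)
      then have r: "d (Suc k) / d k \<le> \<rho>0" using dk by (simp add: field_simps)
      have "d k \<le> ?g (d (Suc k) / d k)"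
        by (rule turan_density_step[OF d(1,2) k dk(2) d(4)])
      also have "\<dots> \<le> ?g \<rho>0"
        using r d(1) by (intro prod_mono) auto
      finally show ?thesis using \<rho>0 by simp
    qed
  qed
qed

subsection \<open>Blowing up disjoint tuples\<close>

text \<open>Jensen's inequality with equal weights for a power on the nonnegative half-line.\<close>

lemma sum_power_Suc_le:
  fixes f :: "'a \<Rightarrow> real"
  assumes "finite A" "\<And>x. x \<in> A \<Longrightarrow> f x \<ge> 0"
  shows "(\<Sum>x\<in>A. f x) ^ Suc t \<le> real (card A) ^ t * (\<Sum>x\<in>A. f x ^ Suc t)"
proof (cases "A = {}")
  case False
  define c where "c = real (card A)"
  have c: "c > 0" using False assms(1) by (simp add: c_def card_gt_0_iff)
  have conv: "convex_on {0..} (\<lambda>x::real. x ^ Suc t)"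
  proof (cases "even (Suc t)")
    case True
    from convex_power_even[OF this] show ?thesis by (rule convex_on_subset) (auto simp: convex_real_interval)
  next
    case False
    then show ?thesis by (rule convex_power_odd)
  qed
  have "(\<Sum>x\<in>A. (1 / c) *\<^sub>R f x) ^ Suc t \<le> (\<Sum>x\<in>A. 1 / c * f x ^ Suc t)"
    by (rule convex_on_sum[OF assms(1) False conv]) (use c assms in \<open>auto simp: c_def\<close>)
  then have "((\<Sum>x\<in>A. f x) / c) ^ Suc t \<le> (\<Sum>x\<in>A. f x ^ Suc t) / c"
    by (simp add: sum_divide_distrib)
  then have "(\<Sum>x\<in>A. f x) ^ Suc t / c ^ Suc t * c ^ Suc t \<le> (\<Sum>x\<in>A. f x ^ Suc t) / c * c ^ Suc t"
    using c by (intro mult_right_mono) (auto simp: power_divide)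
  then show ?thesis using c by (simp add: c_def[symmetric] mult.commute)
qed simp

text \<open>Entries may repeat, so the count is an exact power. \<open>tuples G 1\<close> stands in
  for \<open>G\<close>, giving single and blown-up coordinates one type.\<close>

definition tuples :: "'a set \<Rightarrow> nat \<Rightarrow> 'a list set" where
  "tuples G t = {xs. set xs \<subseteq> G \<and> length xs = t}"

text \<open>Entries within one list may still intersect.\<close>

definition disj :: "'a set list \<Rightarrow> 'a set list \<Rightarrow> bool" where
  "disj xs ys \<longleftrightarrow> disjnt (\<Union>(set xs)) (\<Union>(set ys))"

lemma finite_tuples: "finite G \<Longrightarrow> finite (tuples G t)"
  unfolding tuples_def by (rule finite_lists_length_eq)

lemma card_tuples: "finite G \<Longrightarrow> card (tuples G t) = card G ^ t"
  unfolding tuples_def by (rule card_lists_length_eq)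

lemma symp_disj: "symp disj"
  by (auto intro: sympI simp: disj_def disjnt_sym)

text \<open>Disjointness from a union is tested entry by entry, so the number of admissible
  \<open>t\<close>-tuples is a \<open>t\<close>-th power.\<close>

lemma nbrs_tuples:
  "nbrs disj (tuples G t) J z = tuples {A \<in> G. \<forall>j\<in>J. disjnt A (\<Union>(set (z j)))} t"
  unfolding nbrs_def tuples_def disj_def disjnt_def by fastforce

text \<open>Fix the other coordinates \<open>z\<close>, leaving \<open>a z\<close> admissible single
  sets. Blowing up coordinate \<open>i\<close> replaces \<open>a z\<close> by
  \<open>a z ^ t\<close>, and the mean of the \<open>t\<close>-th power is at least the
  \<open>t\<close>-th power of the mean.\<close>

lemma density_blowup_step:
  assumes "finite J" "i \<notin> J" "finite G" "G \<noteq> {}" "t > 0"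
    and F: "\<And>j. j \<in> J \<Longrightarrow> finite (F j) \<and> F j \<noteq> {}" and Fi: "F i = tuples G 1"
  shows "density disj F (insert i J) ^ t \<le> density disj (F(i := tuples G t)) (insert i J)"
proof -
  define C where "C = cliques disj F J"
  define P where "P = (\<Prod>j\<in>J. real (card (F j)))"
  define m where "m = real (card G)"
  define a where "a z = real (card {A \<in> G. \<forall>j\<in>J. disjnt A (\<Union>(set (z j)))})" for z
  have P: "P > 0" unfolding P_def using F by (intro prod_pos) (auto simp: card_gt_0_iff)
  have m: "m > 0" using assms by (simp add: m_def card_gt_0_iff)
  have finC: "finite C" unfolding C_def using assms F by (intro finite_cliques) auto
  \<comment> \<open>General \<open>u\<close> covers both the original family (\<open>u = 1\<close>)
    and the blown-up one (\<open>u = t\<close>).\<close>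
  have card_F': "real (card (cliques disj (F(i := tuples G u)) (insert i J))) = (\<Sum>z\<in>C. a z ^ u)" for u
  proof -
    have eq: "cliques disj (F(i := tuples G u)) J = C"
      unfolding C_def using assms(2) by (intro cliques_cong) auto
    have "card (cliques disj (F(i := tuples G u)) (insert i J))
        = (\<Sum>z\<in>C. card (nbrs disj (tuples G u) J z))"
      using card_cliques_insert[OF symp_disj assms(2,1), of "F(i := tuples G u)"] assms(3) F
      by (force simp: eq finite_tuples)
    then show ?thesis
      using assms(3) by (simp add: nbrs_tuples card_tuples a_def)
  qed
  have dens: "density disj (F(i := tuples G u)) (insert i J) = (\<Sum>z\<in>C. a z ^ u) / (m ^ u * P)" for u
  proof -
    have "(\<Prod>j\<in>J. real (card ((F(i := tuples G u)) j))) = P"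
      unfolding P_def using assms(2) by (intro prod.cong) auto
    then show ?thesis
      unfolding density_def card_F' using assms by (simp add: card_tuples m_def)
  qed
  have F1: "F(i := tuples G 1) = F" by (simp only: Fi[symmetric] fun_upd_triv)
  have CP: "real (card C) \<le> P"
    unfolding C_def P_def of_nat_prod[symmetric] of_nat_le_iff
    using assms(1) F by (intro card_cliques_le) auto
  obtain u where t: "t = Suc u" using assms(5) gr0_implies_Suc by blast
  have "(\<Sum>z\<in>C. a z) ^ t \<le> real (card C) ^ u * (\<Sum>z\<in>C. a z ^ t)"
    unfolding t by (rule sum_power_Suc_le[OF finC]) (simp add: a_def)
  \<comment> \<open>The mean runs over all \<open>P\<close> choices of the other coordinates; those
    that are not cliques contribute 0.\<close>
  also have "\<dots> \<le> P ^ u * (\<Sum>z\<in>C. a z ^ t)"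
    using CP by (intro mult_right_mono power_mono sum_nonneg) (auto simp: a_def)
  finally have "(\<Sum>z\<in>C. a z) ^ t / (m * P) ^ t \<le> P ^ u * (\<Sum>z\<in>C. a z ^ t) / (m * P) ^ t"
    using m P by (intro divide_right_mono) auto
  also have "\<dots> = (\<Sum>z\<in>C. a z ^ t) / (m ^ t * P)"
    using m P by (simp add: t power_mult_distrib)
  finally show ?thesis
    using dens[of 1] dens[of t] unfolding F1 by (simp add: power_divide)
qed

text \<open>\<open>J\<close> holds the coordinates already blown up; each costs another
  \<open>t\<close>-th power, and the exponents multiply.\<close>

lemma density_blowup:
  assumes "finite I" "J \<subseteq> I" "finite G" "G \<noteq> {}" "t > 0"
  shows "density disj (\<lambda>_. tuples G 1) I ^ (t ^ card J)
    \<le> density disj (\<lambda>j. tuples G (if j \<in> J then t else 1)) I"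
proof -
  have "finite J" using assms finite_subset by blast
  then show ?thesis using assms(2)
  proof (induction J)
    case (insert j J)
    let ?F = "\<lambda>J j. tuples G (if j \<in> J then t else 1)"
    have I: "insert j (I - {j}) = I" using insert.prems by auto
    have F: "(?F J)(j := tuples G t) = ?F (insert j J)" by (auto simp: fun_eq_iff)
    have "tuples G u \<noteq> {}" for u
      using card_tuples[OF assms(3), of u] assms(3,4) by (metis card_eq_0_iff power_not_zero)
    then have "density disj (?F J) (insert j (I - {j})) ^ t
        \<le> density disj ((?F J)(j := tuples G t)) (insert j (I - {j}))"
      using assms insert.hyps by (intro density_blowup_step) (auto simp: finite_tuples)
    then have *: "density disj (?F J) I ^ t \<le> density disj (?F (insert j J)) I"
      unfolding F I .
    have "density disj (\<lambda>_. tuples G 1) I ^ (t ^ card (insert j J))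
        = (density disj (\<lambda>_. tuples G 1) I ^ (t ^ card J)) ^ t"
      using insert.hyps by (simp add: power_mult[symmetric] mult.commute)
    also have "\<dots> \<le> density disj (?F J) I ^ t"
      using insert by (intro power_mono) (auto simp: density_nonneg)
    also note *
    finally show ?case .
  qed simp
qed

section \<open>Tuples with a small union\<close>

text \<open>There are at most 2^n small sets \<open>S\<close>, and at most 2^(nt/r) tuples of
  subsets of each. The surplus 2^(\<delta>nt) \<ge> 2^(2n) in the lower bound for
  \<open>card \<G> ^ t\<close> pays for the choice of \<open>S\<close> and for the factor
  \<open>card \<G>\<close>, itself at most 2^n.\<close>

lemma few_tuples_small_union:
  fixes r n t :: nat and \<delta> :: real
  assumes "\<G> \<subseteq> Pow {1..n}" "r > 0" "2 \<le> \<delta> * real t"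
    and m: "2 powr ((1 / real r + \<delta>) * real n) \<le> real (card \<G>)"
  shows "real (card {xs \<in> tuples \<G> t. r * card (\<Union>(set xs)) \<le> n}) * real (card \<G>) \<le> real (card \<G>) ^ t"
proof -
  define \<S> where "\<S> = {S. S \<subseteq> {1..n} \<and> r * card S \<le> n}"
  have fin: "finite \<S>" unfolding \<S>_def by (rule finite_subset[of _ "Pow {1..n}"]) auto
  have "card \<S> \<le> card (Pow {1..n})" by (rule card_mono) (auto simp: \<S>_def)
  then have card_\<S>: "real (card \<S>) \<le> 2 powr real n"
    by (simp add: card_Pow powr_realpow numeral_power_le_of_nat_cancel_iff flip: of_nat_le_iff)
  have "card \<G> \<le> card (Pow {1..n})" using assms(1) by (intro card_mono) auto
  then have card_\<G>: "real (card \<G>) \<le> 2 powr real n"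
    by (simp add: card_Pow powr_realpow flip: of_nat_le_iff)
  have each: "real (card (tuples (Pow S) t)) \<le> 2 powr (real n / real r * real t)" if S: "S \<in> \<S>" for S
  proof -
    have fS: "finite S" using S finite_subset by (auto simp: \<S>_def)
    have "real r * real (card S) \<le> real n" using S by (simp add: \<S>_def flip: of_nat_mult)
    then have "real (card S) \<le> real n / real r" using assms(2) by (simp add: field_simps)
    then have "2 powr (real (card S) * real t) \<le> 2 powr (real n / real r * real t)"
      by (intro powr_mono mult_right_mono) auto
    moreover have "real (card (tuples (Pow S) t)) = 2 powr (real (card S) * real t)"
      using fS by (simp add: card_tuples card_Pow power_mult[symmetric] powr_realpow flip: of_nat_mult)
    ultimately show ?thesis by simp
  qed
  have "{xs \<in> tuples \<G> t. r * card (\<Union>(set xs)) \<le> n} \<subseteq> (\<Union>S\<in>\<S>. tuples (Pow S) t)"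
  proof
    fix xs assume xs: "xs \<in> {xs \<in> tuples \<G> t. r * card (\<Union>(set xs)) \<le> n}"
    then have "\<Union>(set xs) \<in> \<S>" using assms(1) by (auto simp: tuples_def \<S>_def)
    moreover have "xs \<in> tuples (Pow (\<Union>(set xs))) t" using xs by (auto simp: tuples_def)
    ultimately show "xs \<in> (\<Union>S\<in>\<S>. tuples (Pow S) t)" by blast
  qed
  then have "card {xs \<in> tuples \<G> t. r * card (\<Union>(set xs)) \<le> n} \<le> card (\<Union>S\<in>\<S>. tuples (Pow S) t)"
    using fin by (intro card_mono) (auto simp: \<S>_def intro!: finite_tuples intro: finite_subset)
  also have "\<dots> \<le> (\<Sum>S\<in>\<S>. card (tuples (Pow S) t))" by (rule card_UN_le[OF fin])
  finally have "real (card {xs \<in> tuples \<G> t. r * card (\<Union>(set xs)) \<le> n})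
      \<le> (\<Sum>S\<in>\<S>. real (card (tuples (Pow S) t)))"
    by (simp flip: of_nat_sum)
  also have "\<dots> \<le> (\<Sum>S\<in>\<S>. 2 powr (real n / real r * real t))" by (intro sum_mono each)
  also have "\<dots> = real (card \<S>) * 2 powr (real n / real r * real t)" by simp
  also have "\<dots> \<le> 2 powr real n * 2 powr (real n / real r * real t)"
    using card_\<S> by (intro mult_right_mono) auto
  finally have "real (card {xs \<in> tuples \<G> t. r * card (\<Union>(set xs)) \<le> n}) * real (card \<G>)
      \<le> (2 powr real n * 2 powr (real n / real r * real t)) * 2 powr real n"
    using card_\<G> by (intro mult_mono) auto
  also have "\<dots> = 2 powr (real n / real r * real t + 2 * real n)"
    by (simp add: powr_add[symmetric] add_ac)
  also have "\<dots> \<le> 2 powr ((1 / real r + \<delta>) * real n * real t)"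
  proof (rule powr_mono)
    have "2 * real n \<le> (\<delta> * real t) * real n" using assms(3) by (intro mult_right_mono) auto
    then show "real n / real r * real t + 2 * real n \<le> (1 / real r + \<delta>) * real n * real t"
      by (simp add: algebra_simps)
  qed simp
  also have "\<dots> = (2 powr ((1 / real r + \<delta>) * real n)) ^ t"
    by (simp add: powr_powr[symmetric] powr_realpow)
  also have "\<dots> \<le> real (card \<G>) ^ t" by (intro power_mono m) simp
  finally show ?thesis .
qed

text \<open>Averaging: \<open>r\<close> disjoint parts all larger than n/r would overfill
  \<open>X\<close>.\<close>

lemma exists_small_part:
  fixes U :: "nat \<Rightarrow> 'a set"
  assumes "r > 0" "finite X" "card X = n" "\<And>j. j < r \<Longrightarrow> U j \<subseteq> X"
    and "\<And>i j. i < r \<Longrightarrow> j < r \<Longrightarrow> i \<noteq> j \<Longrightarrow> U i \<inter> U j = {}"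
  obtains j where "j < r" "r * card (U j) \<le> n"
proof (rule ccontr)
  assume "\<not> thesis"
  then have "\<And>j. j < r \<Longrightarrow> n < r * card (U j)" using that not_le by blast
  then have "(\<Sum>j<r. n) < (\<Sum>j<r. r * card (U j))"
    using assms(1) by (intro sum_strict_mono) auto
  then have "r * n < r * (\<Sum>j<r. card (U j))" by (simp add: sum_distrib_left)
  then have "n < (\<Sum>j<r. card (U j))" by simp
  also have "\<dots> = card (\<Union>j<r. U j)"
  proof (rule card_UN_disjoint[symmetric])
    show "\<forall>i\<in>{..<r}. finite (U i)" using assms(2,4) by (auto intro: finite_subset)
    show "\<forall>i\<in>{..<r}. \<forall>j\<in>{..<r}. i \<noteq> j \<longrightarrow> U i \<inter> U j = {}" using assms(5) by simp
  qed simp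
  also have "\<dots> \<le> card X" using assms by (intro card_mono) auto
  finally show False using assms by simp
qed

text \<open>Some coordinate of each clique has a small union, which a given coordinate has with
  probability at most \<open>1 / card \<G>\<close>; sum over the \<open>r\<close>
  coordinates.\<close>

lemma density_tuples_le:
  fixes r n t :: nat and \<delta> :: real
  assumes G: "\<G> \<subseteq> Pow {1..n}" "\<G> \<noteq> {}" and r: "r > 0" and t: "2 \<le> \<delta> * real t"
    and m: "2 powr ((1 / real r + \<delta>) * real n) \<le> real (card \<G>)"
  shows "density disj (\<lambda>_. tuples \<G> t) {..<r} \<le> real r / real (card \<G>)"
proof -
  let ?m = "real (card \<G>)"
  define S where "S = {xs \<in> tuples \<G> t. r * card (\<Union>(set xs)) \<le> n}"
  have finG: "finite \<G>" using G finite_subset by blast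
  then have m0: "?m > 0" using G by (simp add: card_gt_0_iff)
  have finS: "finite S" by (simp add: S_def finite_tuples finG)
  \<comment> \<open>Coordinate \<open>j\<close> is confined to small unions and the rest are free:
    once \<open>j\<close> is found, disjointness is dropped so that the count factorises.\<close>
  define F where "F j = (\<lambda>i. if i = j then S else tuples \<G> t)" for j :: nat
  have "cliques disj (\<lambda>_. tuples \<G> t) {..<r} \<subseteq> (\<Union>j<r. Pi\<^sub>E {..<r} (F j))"
  proof
    fix f assume f: "f \<in> cliques disj (\<lambda>_. tuples \<G> t) {..<r}"
    then have ft: "i < r \<Longrightarrow> f i \<in> tuples \<G> t" for i by (auto simp: cliques_def)
    obtain j where j: "j < r" "r * card (\<Union>(set (f j))) \<le> n"
    proof (rule exists_small_part[of r "{1..n}" n "\<lambda>j. \<Union>(set (f j))"])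
      show "\<Union>(set (f j)) \<subseteq> {1..n}" if "j < r" for j
        using ft[OF that] G by (auto simp: tuples_def)
      show "\<Union>(set (f i)) \<inter> \<Union>(set (f j)) = {}" if "i < r" "j < r" "i \<noteq> j" for i j
        using f that unfolding cliques_def disj_def disjnt_def by blast
    qed (use r in auto)
    then have "f \<in> Pi\<^sub>E {..<r} (F j)"
      using f ft by (auto simp: cliques_def F_def S_def PiE_def)
    then show "f \<in> (\<Union>j<r. Pi\<^sub>E {..<r} (F j))" using j by blast
  qed
  then have "card (cliques disj (\<lambda>_. tuples \<G> t) {..<r}) \<le> card (\<Union>j<r. Pi\<^sub>E {..<r} (F j))"
    by (intro card_mono) (auto simp: F_def finS finG finite_tuples intro!: finite_PiE)
  also have "\<dots> \<le> (\<Sum>j<r. card (Pi\<^sub>E {..<r} (F j)))" by (rule card_UN_le) simp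
  also have "\<dots> = (\<Sum>j<r. card S * card (tuples \<G> t) ^ (r - 1))"
  proof (rule sum.cong[OF refl])
    fix j assume j: "j \<in> {..<r}"
    have "card (Pi\<^sub>E {..<r} (F j)) = card (F j j) * (\<Prod>i\<in>{..<r} - {j}. card (F j i))"
      using j by (simp add: card_PiE prod.remove[of _ j])
    also have "(\<Prod>i\<in>{..<r} - {j}. card (F j i)) = (\<Prod>i\<in>{..<r} - {j}. card (tuples \<G> t))"
      by (intro prod.cong) (auto simp: F_def)
    finally show "card (Pi\<^sub>E {..<r} (F j)) = card S * card (tuples \<G> t) ^ (r - 1)"
      using j by (simp add: F_def)
  qed
  finally have "card (cliques disj (\<lambda>_. tuples \<G> t) {..<r}) \<le> r * (card S * card (tuples \<G> t) ^ (r - 1))"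
    by simp
  then have "real (card (cliques disj (\<lambda>_. tuples \<G> t) {..<r}))
      \<le> real r * (real (card S) * (?m ^ t) ^ (r - 1))"
    by (simp add: card_tuples finG flip: of_nat_mult of_nat_power)
  also have "\<dots> \<le> real r * (?m ^ t / ?m * (?m ^ t) ^ (r - 1))"
    using few_tuples_small_union[OF G(1) r t m] m0
    by (intro mult_left_mono mult_right_mono) (auto simp: S_def pos_le_divide_eq)
  also have "\<dots> = real r / ?m * (?m ^ t * (?m ^ t) ^ (r - 1))" by simp
  also have "?m ^ t * (?m ^ t) ^ (r - 1) = (?m ^ t) ^ r"
    using r by (cases r) auto
  finally show ?thesis
    unfolding density_def using m0 by (simp add: card_tuples finG divide_le_eq)
qed

text \<open>All \<open>r\<close> coordinates are blown up. For fixed \<open>t\<close> and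
  \<open>r\<close> this forces the density to 0 as the family grows.\<close>

lemma density_disjoint_tuples_le:
  fixes r n t :: nat and \<delta> :: real
  assumes G: "\<G> \<subseteq> Pow {1..n}" "\<G> \<noteq> {}" and r: "r > 0" and t: "t > 0" "2 \<le> \<delta> * real t"
    and m: "2 powr ((1 / real r + \<delta>) * real n) \<le> real (card \<G>)"
  shows "density disj (\<lambda>_. tuples \<G> 1) {..<r} ^ (t ^ r) \<le> real r / real (card \<G>)"
proof -
  have "finite \<G>" using G finite_subset by blast
  have "density disj (\<lambda>_. tuples \<G> 1) {..<r} ^ (t ^ card {..<r})
      \<le> density disj (\<lambda>j. tuples \<G> (if j \<in> {..<r} then t else 1)) {..<r}"
    using density_blowup[of "{..<r}" "{..<r}" \<G> t] \<open>finite \<G>\<close> G t by blast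
  also have "\<dots> = density disj (\<lambda>_. tuples \<G> t) {..<r}"
    unfolding density_def
    using cliques_cong[of "{..<r}" "\<lambda>j. tuples \<G> (if j \<in> {..<r} then t else 1)" "\<lambda>_. tuples \<G> t" disj]
    by simp
  also have "\<dots> \<le> real r / real (card \<G>)" by (rule density_tuples_le[OF G r t(2) m])
  finally show ?thesis by simp
qed

section \<open>From ordered tuples to unordered families\<close>

text \<open>The \<open>fact k\<close> orderings of a family give different cliques. Equality can
  fail because an ordered clique may repeat the empty set.\<close>

lemma card_disjoint_families_le:
  assumes "finite \<G>"
  shows "card {\<A>. \<A> \<subseteq> \<G> \<and> card \<A> = k \<and> pairwise disjnt \<A>} * fact k
    \<le> card (cliques disj (\<lambda>_. tuples \<G> 1) {..<k})"
proof -
  define N where "N = {\<A>. \<A> \<subseteq> \<G> \<and> card \<A> = k \<and> pairwise disjnt \<A>}"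
  have finN: "finite N" unfolding N_def using assms by simp
  have finA: "\<A> \<in> N \<Longrightarrow> finite \<A>" for \<A> using assms finite_subset by (auto simp: N_def)
  have perm: "set xs = \<A>" "distinct xs" "length xs = k"
    if "\<A> \<in> N" "xs \<in> permutations_of_set \<A>" for \<A> xs
    using permutations_of_setD[OF that(2)] that(1) distinct_card[of xs] by (auto simp: N_def)
  \<comment> \<open>Each set becomes a one-entry list, to fit \<open>tuples \<G> 1\<close>.\<close>
  let ?f = "\<lambda>(\<A>, xs). \<lambda>i\<in>{..<k}. [xs ! i]"
  have "card N * fact k = (\<Sum>\<A>\<in>N. card (permutations_of_set \<A>))"
  proof -
    have "(\<Sum>\<A>\<in>N. card (permutations_of_set \<A>)) = (\<Sum>\<A>\<in>N. fact k)"
    proof (rule sum.cong[OF refl])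
      fix \<A> assume "\<A> \<in> N"
      then have "finite \<A>" "card \<A> = k" by (rule finA, simp add: N_def)
      then show "card (permutations_of_set \<A>) = fact k" by simp
    qed
    then show ?thesis by simp
  qed
  also have "\<dots> = card (SIGMA \<A>:N. permutations_of_set \<A>)"
    using finN finA by (intro card_SigmaI[symmetric]) auto
  also have "\<dots> \<le> card (cliques disj (\<lambda>_. tuples \<G> 1) {..<k})"
  proof (rule card_inj_on_le[where f = ?f])
    show "inj_on ?f (SIGMA \<A>:N. permutations_of_set \<A>)"
    proof (rule inj_onI, clarify)
      fix \<A> xs \<B> ys
      assume *: "\<A> \<in> N" "xs \<in> permutations_of_set \<A>" "\<B> \<in> N" "ys \<in> permutations_of_set \<B>"
        and eq: "(\<lambda>i\<in>{..<k}. [xs ! i]) = (\<lambda>i\<in>{..<k}. [ys ! i])"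
      have "xs ! i = ys ! i" if "i < k" for i using fun_cong[OF eq, of i] that by simp
      moreover have "length xs = k" "length ys = k" using perm(3) * by blast+
      ultimately have "xs = ys" by (simp add: nth_equalityI)
      moreover have "set xs = \<A>" "set ys = \<B>" using perm(1) * by blast+
      ultimately show "\<A> = \<B> \<and> xs = ys" by simp
    qed
    show "?f ` (SIGMA \<A>:N. permutations_of_set \<A>) \<subseteq> cliques disj (\<lambda>_. tuples \<G> 1) {..<k}"
    proof clarify
      fix \<A> xs assume *: "\<A> \<in> N" "xs \<in> permutations_of_set \<A>"
      note p = perm[OF this]
      have "xs ! i \<in> \<A>" if "i < k" for i using p that by auto
      moreover have "xs ! i \<noteq> xs ! j" if "i < k" "j < k" "i \<noteq> j" for i j
        using p that by (simp add: nth_eq_iff_index_eq)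
      ultimately show "(\<lambda>i\<in>{..<k}. [xs ! i]) \<in> cliques disj (\<lambda>_. tuples \<G> 1) {..<k}"
        using *(1) by (auto simp: cliques_def disj_def tuples_def N_def pairwise_def)
    qed
    show "finite (cliques disj (\<lambda>_. tuples \<G> 1) {..<k})"
      by (intro finite_cliques finite_tuples assms) simp
  qed
  finally show ?thesis unfolding N_def .
qed

text \<open>The quotient of \<open>fact k * (m choose k)\<close> by \<open>m ^ k\<close> is a
  product tending to 1, so the gap between \<open>a\<close> and \<open>b\<close> eventually absorbs
  the difference.\<close>

lemma power_le_fact_mult_choose:
  fixes a b :: real
  assumes "a < b"
  shows "eventually (\<lambda>m. a * real m ^ k \<le> b * (fact k * real (m choose k))) sequentially"
proof -
  have "(\<lambda>m. b * (\<Prod>i = 0..<k. 1 - real i / real m)) \<longlonglongrightarrow> b * (\<Prod>i = 0..<k. 1 - 0)"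
    by (intro tendsto_intros tendsto_divide_0[OF tendsto_const] filterlim_real_sequentially
        filterlim_mono[OF filterlim_real_sequentially at_top_le_at_infinity order_refl])
  then have "eventually (\<lambda>m. a < b * (\<Prod>i = 0..<k. 1 - real i / real m)) sequentially"
    by (rule order_tendstoD) (use assms in simp)
  then show ?thesis
    using eventually_gt_at_top[of 0]
  proof eventually_elim
    case (elim m)
    have "fact k * real (m choose k) = (\<Prod>i = 0..<k. real m - real i)"
      by (simp add: binomial_gbinomial gbinomial_mult_fact)
    also have "\<dots> = (\<Prod>i = 0..<k. (1 - real i / real m) * real m)"
      using elim by (intro prod.cong) (auto simp: field_simps)
    also have "\<dots> = (\<Prod>i = 0..<k. 1 - real i / real m) * real m ^ k"
      by (simp add: prod.distrib)
    finally have "b * (fact k * real (m choose k)) = b * (\<Prod>i = 0..<k. 1 - real i / real m) * real m ^ k"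
      by (simp only: mult.assoc)
    moreover have "a * real m ^ k \<le> b * (\<Prod>i = 0..<k. 1 - real i / real m) * real m ^ k"
      using elim by (intro mult_right_mono) auto
    ultimately show ?case by (simp only:)
  qed
qed

theorem theorem3:
  fixes k :: nat and \<delta> \<epsilon> :: real
  assumes "k > 0" and "\<delta> > 0" and "\<epsilon> > 0"
  shows "\<exists>M::nat. \<forall>(n::nat) (m::nat) (\<G> :: nat set set).
           n > 0 \<longrightarrow> \<G> \<subseteq> Pow {1..n} \<longrightarrow> card \<G> = m \<longrightarrow> m \<ge> M \<longrightarrow>
           real m \<ge> 2 powr ((1 / (real k + 1) + \<delta>) * real n) \<longrightarrow>
           real (card {\<A>. \<A> \<subseteq> \<G> \<and> card \<A> = k \<and> pairwise disjnt \<A>})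
             \<le> (fact k / real k ^ k + \<epsilon>) * real (m choose k)"
proof -
  define c where "c = fact k / real k ^ k"
  define t where "t = nat \<lceil>2 / \<delta>\<rceil>"
  have "2 / \<delta> \<le> real t" unfolding t_def by linarith
  then have t: "2 \<le> \<delta> * real t" using assms(2) by (simp add: field_simps)
  then have t0: "t > 0" by (cases t) auto
  \<comment> \<open>Half of \<open>\<epsilon>\<close> goes to the Turan bound, the other half to
    replacing \<open>m ^ k\<close> by \<open>fact k * (m choose k)\<close>.\<close>
  obtain \<eta> where \<eta>: "\<eta> > 0"
    and turan: "\<And>d :: nat \<Rightarrow> real. \<lbrakk>\<And>s. d s \<ge> 0; d 0 = 1; d (Suc k) \<le> \<eta>;
       \<And>s. real (Suc s) * d (Suc s) ^ 2 \<le> d s * (real s * d (Suc (Suc s)) + d (Suc s))\<rbrakk>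
       \<Longrightarrow> d k \<le> fact k / real k ^ k + \<epsilon> / 2"
    using turan_density[OF assms(1), of "\<epsilon> / 2"] assms(3) by (metis half_gt_zero)
  let ?e = "t ^ Suc k"
  obtain M1 where M1: "\<And>m. m \<ge> M1 \<Longrightarrow>
      (c + \<epsilon> / 2) * real m ^ k \<le> (c + \<epsilon>) * (fact k * real (m choose k))"
    using power_le_fact_mult_choose[of "c + \<epsilon> / 2" "c + \<epsilon>" k] assms(3)
    by (auto simp: eventually_sequentially)
  \<comment> \<open>Beyond \<open>M2\<close> the bound \<open>(k+1)/m\<close> drops below
    \<open>\<eta> ^ ?e\<close>, and taking roots gives
    \<open>d (Suc k) \<le> \<eta>\<close>.\<close>
  obtain M2 where M2: "real (Suc k) / \<eta> ^ ?e \<le> real M2" using real_arch_simple by blast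
  show ?thesis
  \<comment> \<open>The witness is \<open>max 1 (max M1 M2)\<close>; the 1 ensures that the family
    is nonempty.\<close>
  proof (intro exI allI impI)
    fix n m :: nat and \<G> :: "nat set set"
    assume n: "n > 0" and G: "\<G> \<subseteq> Pow {1..n}" and cG: "card \<G> = m"
      and M: "m \<ge> max 1 (max M1 M2)" and m: "real m \<ge> 2 powr ((1 / (real k + 1) + \<delta>) * real n)"
    define d where "d s = density disj (\<lambda>_. tuples \<G> 1) {..<s::nat}" for s
    have finG: "finite \<G>" using G finite_subset by blast
    have m0: "m > 0" using M by simp
    then have neG: "\<G> \<noteq> {}" using cG by auto
    have cT: "card (tuples \<G> 1) = m" using finG cG by (simp add: card_tuples)
    have "d (Suc k) ^ ?e \<le> real (Suc k) / real m"
      using density_disjoint_tuples_le[OF G neG _ t0 t, of "Suc k"] m cG by (simp add: d_def add.commute)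
    also have "\<dots> \<le> \<eta> ^ ?e"
    proof -
      have "real (Suc k) / \<eta> ^ ?e \<le> real m" using M2 M by linarith
      then show ?thesis using \<eta> m0 by (simp add: divide_le_eq mult.commute)
    qed
    finally have "d (Suc k) ^ ?e \<le> \<eta> ^ ?e" .
    moreover have "d (Suc k) \<ge> 0" by (simp add: d_def density_nonneg)
    ultimately have small: "d (Suc k) \<le> \<eta>"
      using \<eta> t0 by (subst (asm) power_mono_iff) auto
    have "d k \<le> c + \<epsilon> / 2" unfolding c_def
    proof (rule turan)
      show "d s \<ge> 0" for s by (simp add: d_def density_nonneg)
      show "d 0 = 1" by (simp add: d_def density_def cliques_def)
      show "real (Suc s) * d (Suc s) ^ 2 \<le> d s * (real s * d (Suc (Suc s)) + d (Suc s))" for s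
        unfolding d_def using cT m0
        by (intro density_moon_moser symp_disj finite_tuples finG) auto
    qed (rule small)
    then have "d k * real m ^ k \<le> (c + \<epsilon> / 2) * real m ^ k" by (intro mult_right_mono) auto
    moreover have "real (card (cliques disj (\<lambda>_. tuples \<G> 1) {..<k})) = d k * real m ^ k"
      unfolding d_def density_def cT using m0 by simp
    moreover have "real (card {\<A>. \<A> \<subseteq> \<G> \<and> card \<A> = k \<and> pairwise disjnt \<A>}) * fact k
        \<le> real (card (cliques disj (\<lambda>_. tuples \<G> 1) {..<k}))"
      using of_nat_mono[OF card_disjoint_families_le[OF finG, of k], where 'a = real]
      by (simp only: of_nat_mult of_nat_fact)
    moreover have "(c + \<epsilon> / 2) * real m ^ k \<le> (c + \<epsilon>) * (fact k * real (m choose k))"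
      using M by (intro M1) simp
    ultimately have "real (card {\<A>. \<A> \<subseteq> \<G> \<and> card \<A> = k \<and> pairwise disjnt \<A>}) * fact k
        \<le> (c + \<epsilon>) * (fact k * real (m choose k))"
      by linarith
    also have "\<dots> = ((c + \<epsilon>) * real (m choose k)) * fact k"
      by (simp only: mult_ac)
    finally have "real (card {\<A>. \<A> \<subseteq> \<G> \<and> card \<A> = k \<and> pairwise disjnt \<A>}) * fact k
        \<le> ((c + \<epsilon>) * real (m choose k)) * fact k" .
    then show "real (card {\<A>. \<A> \<subseteq> \<G> \<and> card \<A> = k \<and> pairwise disjnt \<A>})
        \<le> (fact k / real k ^ k + \<epsilon>) * real (m choose k)"
      unfolding c_def by (simp only: mult_le_cancel_right_pos fact_gt_zero)
  qed
qed

end
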